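(* For every $k\in\{1,\dots,J\}$ and every $v\in V_k$, $$\| v - \tilde{B}^{ns}_k[A_kv] \|_{A_k} \leq \| v - \hat{B}^{ns}_k[A_kv] \|_{A_k} \leq \| v - B^{ns}_kA_kv \|_{A_k},$$ where $B^{ns}_k$ is the (linear) $\backslash$-cycle multigrid operator, $\hat{B}^{ns}_k[\cdot]$ is the nonsymmetric nonlinear AMLI-cycle multigrid operator, and $\tilde{B}^{ns}_k[\cdot]$ is given by $n\ge 1$ steps of the (full) nonlinear PCG method with $\hat{B}^{ns}_k[\cdot]$ as the preconditioner.
   Context: Setting. $V$ is a finite-dimensional real vector space with inner product $(\cdot,\cdot)$ and norm $\|\cdot\|$; $A:V\to V$ is symmetric positive definite (SPD) with respect to $(\cdot,\cdot)$; $(u,v)_A=(Au,v)$. $V_1\subset V_2\subset\cdots\subset V_J=V$ are nested subspaces. $Q_k,P_k:V\to V_k$ are the orthogonal projections with respect to $(\cdot,\cdot)$ and $(\cdot,\cdot)_A$. $A_k:V_k\to V_k$ is defined by $(A_ku_k,v_k)=(u_k,v_k)_A$ for $u_k,v_k\in V_k$; it is SPD, $(u,v)_{A_k}=(A_ku,v)$, with norm $\|\cdot\|_{A_k}$. $R_k:V_k\to V_k$ ($2\le k\le J$) are given linear smoothers. $\backslash$-cycle: $B_1^{ns}=A_1^{-1}$ and, for $k\ge2$, $f\in V_k$, with $u_1=R_kf$: $B_k^{ns}f=u_1+B_{k-1}^{ns}Q_{k-1}(f-A_ku_1)$. Nonlinear PCG ($n$ steps, full version, $n\ge1$ fixed)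 on $V_k$ with a given, possibly nonlinear, preconditioner $\hat B_k[\cdot]:V_k\to V_k$: for $f\in V_k$ put $u_0=0$, $r_0=f$, $p_0=\hat B_k[r_0]$; for $i=1,\dots,n-1$, $p_i=\hat B_k[r_i]+\sum_{j=0}^{i-1}\beta_{i,j}p_j$ with $\beta_{i,j}=-(\hat B_k[r_i],p_j)_{A_k}/(p_j,p_j)_{A_k}$; for $i=0,\dots,n-1$, $\alpha_i=(r_i,p_i)/(p_i,p_i)_{A_k}$, $u_{i+1}=u_i+\alpha_ip_i$, $r_{i+1}=r_i-\alpha_iA_kp_i$. The output is $\tilde B_k[f]:=u_n$. Convention: a coefficient $\alpha_i$ or $\beta_{i,j}$ whose denominator vanishes is taken to be $0$. Nonsymmetric nonlinear AMLI-cycle: $\hat B_1^{ns}[f]=A_1^{-1}f$ and, for $k\ge2$, $f\in V_k$, with $u_1=R_kf$: $\hat B_k^{ns}[f]=u_1+\tilde B_{k-1}^{ns}[Q_{k-1}(f-A_ku_1)]$, where on each level $\tilde B_{j}^{ns}[\cdot]$ is the operator produced by $n$ steps of nonlinear PCG on $V_{j}$ with preconditioner $\hat B_{j}^{ns}[\cdot]$. *)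

theory Defs
  imports "HOL-Analysis.Analysis"
begin

definition op_inner :: "('a::real_inner \<Rightarrow> 'a) \<Rightarrow> 'a \<Rightarrow> 'a \<Rightarrow> real" where
  "op_inner T u v = T u \<bullet> v"

definition op_norm :: "('a::real_inner \<Rightarrow> 'a) \<Rightarrow> 'a \<Rightarrow> real" where
  "op_norm T u = sqrt (op_inner T u u)"

definition spd :: "('a::real_inner \<Rightarrow> 'a) \<Rightarrow> bool" where
  "spd A \<longleftrightarrow> linear A \<and> (\<forall>u v. A u \<bullet> v = u \<bullet> A v) \<and> (\<forall>u. u \<noteq> 0 \<longrightarrow> 0 < A u \<bullet> u)"

definition linear_endo_on :: "'a::real_vector set \<Rightarrow> ('a \<Rightarrow> 'a) \<Rightarrow> bool" where
  "linear_endo_on W T \<longleftrightarrow> T ` W \<subseteq> W \<and>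
     (\<forall>u\<in>W. \<forall>v\<in>W. T (u + v) = T u + T v) \<and>
     (\<forall>c. \<forall>u\<in>W. T (c *\<^sub>R u) = c *\<^sub>R T u)"

definition orth_proj :: "'a::real_inner set \<Rightarrow> 'a \<Rightarrow> 'a" where
  "orth_proj W u = (THE w. w \<in> W \<and> (\<forall>z\<in>W. w \<bullet> z = u \<bullet> z))"

text \<open>The operator \<open>A\<^sub>k\<close> on \<open>W = V\<^sub>k\<close>, characterised by
  \<open>(A\<^sub>k u, v) = (u, v)\<^sub>A\<close> for all \<open>v \<in> V\<^sub>k\<close>. It is only of interest for \<open>u \<in> W\<close>.\<close>

definition level_op :: "('a::real_inner \<Rightarrow> 'a) \<Rightarrow> 'a set \<Rightarrow> 'a \<Rightarrow> 'a" where
  "level_op A W u = (THE w. w \<in> W \<and> (\<forall>v\<in>W. w \<bullet> v = op_inner A u v))"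

definition level_inv :: "('a::real_inner \<Rightarrow> 'a) \<Rightarrow> 'a set \<Rightarrow> 'a \<Rightarrow> 'a" where
  "level_inv A W = inv_into W (level_op A W)"

text \<open>Levels are numbered from 1, so the recursions over levels have no equation for level 0.\<close>

fun backslash_cycle ::
  "('a::real_inner \<Rightarrow> 'a) \<Rightarrow> (nat \<Rightarrow> 'a set) \<Rightarrow> (nat \<Rightarrow> 'a \<Rightarrow> 'a) \<Rightarrow> nat \<Rightarrow> 'a \<Rightarrow> 'a" where
  "backslash_cycle A V R (Suc 0) f = level_inv A (V 1) f"
| "backslash_cycle A V R (Suc (Suc j)) f =
     (let k = Suc (Suc j); u1 = R k f
      in u1 + backslash_cycle A V R (Suc j)
                (orth_proj (V (Suc j)) (f - level_op A (V k) u1)))"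

text \<open>Nonlinear PCG for the operator \<open>T\<close> (below: \<open>A\<^sub>k\<close>) with preconditioner \<open>B\<close> and
  right-hand side \<open>f\<close>. Because \<open>x / 0 = 0\<close>, a coefficient whose denominator vanishes is 0.
  For \<open>i = 0\<close> the sum in \<open>pcg_p\<close> is empty, so \<open>p\<^sub>0 = B[r\<^sub>0]\<close>.\<close>

function (sequential)
  pcg_p :: "('a::real_inner \<Rightarrow> 'a) \<Rightarrow> ('a \<Rightarrow> 'a) \<Rightarrow> 'a \<Rightarrow> nat \<Rightarrow> 'a" and
  pcg_r :: "('a::real_inner \<Rightarrow> 'a) \<Rightarrow> ('a \<Rightarrow> 'a) \<Rightarrow> 'a \<Rightarrow> nat \<Rightarrow> 'a" where
  "pcg_p T B f i = B (pcg_r T B f i) +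
     (\<Sum>j<i. (- (op_inner T (B (pcg_r T B f i)) (pcg_p T B f j)
                / op_inner T (pcg_p T B f j) (pcg_p T B f j))) *\<^sub>R pcg_p T B f j)"
| "pcg_r T B f 0 = f"
| "pcg_r T B f (Suc i) = pcg_r T B f i -
     ((pcg_r T B f i \<bullet> pcg_p T B f i)
        / op_inner T (pcg_p T B f i) (pcg_p T B f i)) *\<^sub>R T (pcg_p T B f i)"
  by pat_completeness auto
termination
  by (relation "Wellfounded.measure (\<lambda>x. case x of Inl (T, B, f, i) \<Rightarrow> 2 * i + 1 | Inr (T, B, f, i) \<Rightarrow> 2 * i)")
    auto

text \<open>The defining equation of \<open>pcg_p\<close> would make the simplifier loop.\<close>
declare pcg_p.simps [simp del]

primrec pcg_u :: "('a::real_inner \<Rightarrow> 'a) \<Rightarrow> ('a \<Rightarrow> 'a) \<Rightarrow> 'a \<Rightarrow> nat \<Rightarrow> 'a" where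
  "pcg_u T B f 0 = 0"
| "pcg_u T B f (Suc i) = pcg_u T B f i +
     ((pcg_r T B f i \<bullet> pcg_p T B f i)
        / op_inner T (pcg_p T B f i) (pcg_p T B f i)) *\<^sub>R pcg_p T B f i"

text \<open>The first argument \<open>n\<close> is the number of nonlinear PCG steps on every level.\<close>

fun amli_hat ::
  "nat \<Rightarrow> ('a::real_inner \<Rightarrow> 'a) \<Rightarrow> (nat \<Rightarrow> 'a set) \<Rightarrow> (nat \<Rightarrow> 'a \<Rightarrow> 'a) \<Rightarrow> nat \<Rightarrow> 'a \<Rightarrow> 'a" where
  "amli_hat n A V R (Suc 0) f = level_inv A (V 1) f"
| "amli_hat n A V R (Suc (Suc j)) f =
     (let k = Suc (Suc j); u1 = R k f
      in u1 + pcg_u (level_op A (V (Suc j))) (amli_hat n A V R (Suc j))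
                (orth_proj (V (Suc j)) (f - level_op A (V k) u1)) n)"

definition amli_tilde ::
  "nat \<Rightarrow> ('a::real_inner \<Rightarrow> 'a) \<Rightarrow> (nat \<Rightarrow> 'a set) \<Rightarrow> (nat \<Rightarrow> 'a \<Rightarrow> 'a) \<Rightarrow> nat \<Rightarrow> 'a \<Rightarrow> 'a" where
  "amli_tilde n A V R k f = pcg_u (level_op A (V k)) (amli_hat n A V R k) f n"

end

theory Submission
  imports Defs
begin

text \<open>
  A PCG step is an exact line search in the energy norm of the level, so it beats both the step
  of length 0 (the error never grows) and, in the first iteration, the step of length 1, which is
  the preconditioner itself. This gives the first inequality; conjugacy of the search directions
  plays no role. The second inequality is an induction on the level: since
  \<open>Q\<^sub>k\<^sub>-\<^sub>1 A\<^sub>k = A\<^sub>k\<^sub>-\<^sub>1 P\<^sub>k\<^sub>-\<^sub>1\<close>, the coarse grid correction only acts on the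
  \<open>A\<close>-orthogonal projection of the error, and Pythagoras reduces level \<open>k\<close> to level \<open>k - 1\<close>.
\<close>

section \<open>Bilinear algebra and Riesz representation for SPD operators\<close>

lemma op_inner_left:
  assumes "linear T"
  shows op_inner_add_left: "op_inner T (x + y) z = op_inner T x z + op_inner T y z"
    and op_inner_diff_left: "op_inner T (x - y) z = op_inner T x z - op_inner T y z"
    and op_inner_scaleR_left: "op_inner T (c *\<^sub>R x) z = c * op_inner T x z"
  using assms by (simp_all add: op_inner_def linear_add linear_diff linear_scale inner_left_distrib
      inner_diff_left)

lemma op_inner_right:
  shows op_inner_add_right: "op_inner T x (y + z) = op_inner T x y + op_inner T x z"
    and op_inner_diff_right: "op_inner T x (y - z) = op_inner T x y - op_inner T x z"
    and op_inner_scaleR_right: "op_inner T x (c *\<^sub>R y) = c * op_inner T x y"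
  by (simp_all add: op_inner_def inner_right_distrib inner_diff_right)

lemma spd_linear: "spd A \<Longrightarrow> linear A"
  by (simp add: spd_def)

lemma spd_commute: "spd A \<Longrightarrow> op_inner A x y = op_inner A y x"
  by (metis spd_def op_inner_def inner_commute)

lemma spd_pos: "spd A \<Longrightarrow> x \<noteq> 0 \<Longrightarrow> 0 < op_inner A x x"
  unfolding spd_def op_inner_def by blast

lemma spd_id: "spd (\<lambda>x. x)"
  by (simp add: spd_def linear_ident)

lemma spd_riesz_span:
  assumes "finite B" "spd A" "linear (g :: 'a::real_inner \<Rightarrow> real)"
  shows "\<exists>w\<in>span B. \<forall>z\<in>span B. op_inner A w z = g z"
  using assms(1,3)
proof (induction B arbitrary: g)
  case empty
  then show ?case by (simp add: op_inner_def linear_0)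
next
  case (insert b B)
  note lin = spd_linear[OF assms(2)]
  have "linear (op_inner A b)"
    by (rule linearI) (simp_all add: op_inner_right)
  \<comment> \<open>The induction hypothesis serves two functionals: that of \<open>b\<close>, whose
    representer \<open>q\<close> is the energy projection of \<open>b\<close> onto
    \<open>span B\<close>, and \<open>g\<close> itself.\<close>
  from insert.IH[OF this] obtain q where
    q: "q \<in> span B" "\<And>z. z \<in> span B \<Longrightarrow> op_inner A q z = op_inner A b z" by blast
  from insert.IH[OF insert.prems] obtain w where
    w: "w \<in> span B" "\<And>z. z \<in> span B \<Longrightarrow> op_inner A w z = g z" by blast
  define d where "d = b - q"
  have sub: "span B \<subseteq> span (insert b B)" by (simp add: span_mono subset_insertI)
  have d_in: "d \<in> span (insert b B)"
    unfolding d_def using q(1) sub by (intro span_diff) (auto simp: span_base)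
  have d_orth: "op_inner A d z = 0" if "z \<in> span B" for z
    using q(2)[OF that] lin by (simp add: d_def op_inner_diff_left)
  \<comment> \<open>This value makes the corrected representer right on \<open>d\<close>. If
    \<open>b\<close> already lies in \<open>span B\<close>, then \<open>d = 0\<close> and the
    correction vanishes.\<close>
  define c where "c = (g d) / op_inner A d d"
  have g_d: "op_inner A (w + c *\<^sub>R d) d = g d"
  proof (cases "d = 0")
    case True
    then show ?thesis using insert.prems by (simp add: op_inner_def linear_0)
  next
    case False
    from spd_pos[OF assms(2) this] show ?thesis
      using spd_commute[OF assms(2), of w d] d_orth[OF w(1)]
      by (simp add: op_inner_add_left op_inner_scaleR_left lin c_def)
  qed
  show ?case
  proof (intro bexI[of _ "w + c *\<^sub>R d"] ballI)
    fix z assume "z \<in> span (insert b B)"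
    then obtain t where t: "z - t *\<^sub>R b \<in> span B" by (auto simp: span_insert)
    define y where "y = z - t *\<^sub>R d"
    have y: "y \<in> span B"
    proof -
      have "y = (z - t *\<^sub>R b) + t *\<^sub>R q" by (simp add: y_def d_def algebra_simps)
      then show ?thesis using t q(1) by (simp add: span_add span_scale)
    qed
    have z: "z = y + t *\<^sub>R d" by (simp add: y_def)
    have "op_inner A (w + c *\<^sub>R d) y = g y"
      using w(2)[OF y] d_orth[OF y] by (simp add: op_inner_add_left op_inner_scaleR_left lin)
    then show "op_inner A (w + c *\<^sub>R d) z = g z"
      using g_d insert.prems
      by (simp add: z op_inner_add_right op_inner_scaleR_right linear_add linear_scale)
  qed (use w(1) sub d_in in \<open>auto intro: span_add span_scale\<close>)
qed

lemma finite_dim_subspace_spanned: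
  fixes W :: "'a::real_vector set"
  assumes "\<exists>S :: 'a set. finite S \<and> span S = UNIV" and "subspace W"
  obtains B where "finite B" "span B = W"
proof -
  obtain S :: "'a set" where S: "finite S" "span S = UNIV" using assms(1) by blast
  obtain B where B: "B \<subseteq> W" "independent B" "W \<subseteq> span B"
    using maximal_independent_subset by blast
  have "finite B" using independent_span_bound[OF S(1) B(2)] S(2) by simp
  moreover have "span B = W" using B assms(2) by (simp add: span_minimal subset_antisym)
  ultimately show thesis by (rule that)
qed

text \<open>Test with \<open>w - w'\<close> itself. Identities between operators given by
  \<open>THE\<close> are reduced by it to comparing inner products on the subspace.\<close>

lemma inner_unique:
  assumes "subspace W" "w \<in> W" "w' \<in> W" "\<And>z. z \<in> W \<Longrightarrow> w \<bullet> z = w' \<bullet> z"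
  shows "w = w'"
proof -
  have "w - w' \<in> W" using assms by (simp add: subspace_diff)
  from assms(4)[OF this] have "(w - w') \<bullet> (w - w') = 0" by (simp add: inner_diff_left)
  then show ?thesis by simp
qed

section \<open>Level operators and projections on a subspace\<close>

locale fin_dim_spd =
  fixes A :: "'a::real_inner \<Rightarrow> 'a"
  assumes fin_dim: "\<exists>S :: 'a set. finite S \<and> span S = UNIV"
    and spd: "spd A"
begin

lemmas op_algebra = op_inner_left[OF spd_linear[OF spd]] op_inner_right

lemma op_pos: "x \<noteq> 0 \<Longrightarrow> 0 < op_inner A x x"
  by (rule spd_pos[OF spd])

lemma op_commute: "op_inner A x y = op_inner A y x"
  by (rule spd_commute[OF spd])

lemma spd_riesz:
  assumes "subspace W" "spd T" "linear (g :: 'a \<Rightarrow> real)"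
  obtains w where "w \<in> W" "\<And>z. z \<in> W \<Longrightarrow> op_inner T w z = g z"
  using finite_dim_subspace_spanned[OF fin_dim assms(1)] spd_riesz_span[OF _ assms(2,3)] by metis

text \<open>Existence is Riesz for the identity operator, uniqueness is \<open>inner_unique\<close>.
  This makes the descriptions in \<open>level_op\<close> and \<open>orth_proj\<close> well
  defined.\<close>

lemma the_inner_repr:
  assumes "subspace W" "linear (g :: 'a \<Rightarrow> real)"
  defines "w \<equiv> (THE w. w \<in> W \<and> (\<forall>z\<in>W. w \<bullet> z = g z))"
  shows "w \<in> W \<and> (\<forall>z\<in>W. w \<bullet> z = g z)"
proof -
  obtain x where x: "x \<in> W" "\<And>z. z \<in> W \<Longrightarrow> x \<bullet> z = g z"
    using spd_riesz[OF assms(1) spd_id assms(2)] by (auto simp: op_inner_def)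
  show ?thesis unfolding w_def
    by (rule theI[of _ x]) (use x inner_unique[OF assms(1)] in auto)
qed

lemma level_op:
  assumes "subspace W"
  shows level_op_in: "level_op A W u \<in> W"
    and level_op_inner: "z \<in> W \<Longrightarrow> level_op A W u \<bullet> z = op_inner A u z"
proof -
  have "linear (op_inner A u)" by (simp add: linearI op_algebra)
  from the_inner_repr[OF assms this]
  show "level_op A W u \<in> W" "z \<in> W \<Longrightarrow> level_op A W u \<bullet> z = op_inner A u z"
    by (simp_all add: level_op_def)
qed

lemma orth_proj:
  fixes W :: "'a set"
  assumes "subspace W"
  shows orth_proj_in: "orth_proj W u \<in> W"
    and orth_proj_inner: "z \<in> W \<Longrightarrow> orth_proj W u \<bullet> z = u \<bullet> z"
proof -
  have "linear (inner u)" by (simp add: linearI inner_right_distrib)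
  from the_inner_repr[OF assms this]
  show "orth_proj W u \<in> W" "z \<in> W \<Longrightarrow> orth_proj W u \<bullet> z = u \<bullet> z"
    by (simp_all add: orth_proj_def)
qed

lemma level_op_diff_scaleR:
  assumes W: "subspace W"
  shows "level_op A W (x - c *\<^sub>R y) = level_op A W x - c *\<^sub>R level_op A W y"
  by (rule inner_unique[OF W])
    (auto simp: W level_op inner_diff_left op_algebra subspace_diff subspace_scale)

text \<open>Lets all later estimates use the single norm of \<open>A\<close> on every level.\<close>

lemma op_norm_level_op:
  assumes "subspace W" "x \<in> W"
  shows "op_norm (level_op A W) x = op_norm A x"
  using level_op_inner[OF assms, of x] by (simp add: op_norm_def op_inner_def)

text \<open>\<open>inv_into\<close> is only controlled on the image of \<open>W\<close>, so
  \<open>f\<close> needs a preimage: the Riesz representer of its inner product functional in the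
  energy form.\<close>

lemma level_inv_in:
  assumes W: "subspace W" and "f \<in> W"
  shows "level_inv A W f \<in> W"
proof -
  have "linear (inner f)" by (simp add: linearI inner_right_distrib)
  from spd_riesz[OF W spd this] obtain w where
    w: "w \<in> W" "\<And>z. z \<in> W \<Longrightarrow> op_inner A w z = f \<bullet> z" by blast
  have "level_op A W w = f"
    by (rule inner_unique[OF W]) (use w assms in \<open>auto simp: level_op\<close>)
  then show ?thesis unfolding level_inv_def using w(1) by (blast intro: inv_into_into)
qed

section \<open>Nonlinear PCG as a sequence of line searches\<close>

lemma pcg_closed:
  assumes W: "subspace W" and B: "\<And>x. x \<in> W \<Longrightarrow> B x \<in> W" and f: "f \<in> W"
  shows "pcg_r (level_op A W) B f i \<in> W \<and> pcg_p (level_op A W) B f i \<in> W"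
\<comment> \<open>Complete induction, because each direction involves all earlier ones; the residual
  comes first, because the direction is built from it.\<close>
proof (induction i rule: less_induct)
  case (less i)
  have r: "pcg_r (level_op A W) B f i \<in> W"
    using less by (cases i) (auto simp: f W level_op_in intro!: subspace_diff subspace_scale)
  have "pcg_p (level_op A W) B f i \<in> W"
    unfolding pcg_p.simps[of _ _ _ i] using less r B
    by (auto intro!: subspace_add[OF W] subspace_sum[OF W] subspace_scale[OF W] subspace_neg[OF W])
  with r show ?case by blast
qed

lemma pcg_u_in:
  assumes W: "subspace W" and B: "\<And>x. x \<in> W \<Longrightarrow> B x \<in> W" and f: "f \<in> W"
  shows "pcg_u (level_op A W) B f i \<in> W"
  using pcg_closed[OF assms]
  by (induction i) (auto simp: subspace_0[OF W] intro!: subspace_add[OF W] subspace_scale[OF W])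

text \<open>The recursion for the residual is that for the iterate with the level operator applied.
  Hence the numerator of \<alpha> is the energy product of the error with the direction.\<close>

lemma pcg_residual:
  assumes W: "subspace W"
  shows "pcg_r (level_op A W) B (level_op A W v) i
    = level_op A W (v - pcg_u (level_op A W) B (level_op A W v) i)"
  by (induction i) (auto simp flip: level_op_diff_scaleR[OF W] simp: diff_diff_eq)

lemma line_search_optimal:
  "op_norm A (x - (op_inner A x p / op_inner A p p) *\<^sub>R p) \<le> op_norm A (x - c *\<^sub>R p)"
proof (cases "p = 0")
  case False
  define s where "s = op_inner A p p"
  define a where "a = op_inner A x p / s"
  have s: "s > 0" using op_pos[OF False] by (simp add: s_def)
  then have xp: "op_inner A x p = a * s" by (simp add: a_def)
  \<comment> \<open>Completing the square in \<open>t\<close>: the minimum is at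
    \<open>t = a\<close>.\<close>
  have *: "op_inner A (x - t *\<^sub>R p) (x - t *\<^sub>R p) = op_inner A x x - a\<^sup>2 * s + (t - a)\<^sup>2 * s" for t
    using op_commute[of p x]
    by (simp add: op_algebra xp flip: s_def) (simp add: algebra_simps power2_eq_square)
  have "op_norm A (x - a *\<^sub>R p) \<le> op_norm A (x - c *\<^sub>R p)"
    unfolding op_norm_def * using s by simp
  then show ?thesis by (simp add: a_def s_def)
qed simp

lemma pcg_step:
  assumes W: "subspace W" and B: "\<And>x. x \<in> W \<Longrightarrow> B x \<in> W"
  defines "T \<equiv> level_op A W"
  shows "op_norm A (v - pcg_u T B (T v) (Suc i))
    \<le> op_norm A (v - pcg_u T B (T v) i - c *\<^sub>R pcg_p T B (T v) i)"
proof -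
  define x where "x = v - pcg_u T B (T v) i"
  define p where "p = pcg_p T B (T v) i"
  have p: "p \<in> W" using pcg_closed[OF W B level_op_in[OF W]] by (simp add: p_def T_def)
  have r: "pcg_r T B (T v) i = T x" using pcg_residual[OF W] by (simp add: x_def T_def)
  have T: "T y \<bullet> p = op_inner A y p" for y using level_op_inner[OF W p] by (simp add: T_def)
  have "v - pcg_u T B (T v) (Suc i) = x - (op_inner A x p / op_inner A p p) *\<^sub>R p"
    by (simp add: x_def diff_diff_eq r T op_inner_def[of T] flip: p_def)
  then show ?thesis using line_search_optimal[of x p c] by (simp only: flip: x_def p_def)
qed

lemma pcg_error_le:
  assumes W: "subspace W" and B: "\<And>x. x \<in> W \<Longrightarrow> B x \<in> W" and "n \<ge> 1"
  defines "T \<equiv> level_op A W"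
  shows "op_norm A (v - pcg_u T B (T v) n) \<le> op_norm A (v - B (T v))"
  using \<open>n \<ge> 1\<close>
proof (induction n rule: dec_induct)
  case base
  \<comment> \<open>At \<open>i = 0\<close> the iterate is 0 and the direction is
    \<open>B (T v)\<close>, so length \<open>c = 1\<close> reproduces the preconditioner's
    error.\<close>
  show ?case using pcg_step[OF W, where B = B and v = v and i = 0 and c = 1] B by (simp add: T_def pcg_p.simps[of _ _ _ 0])
next
  case (step i)
  \<comment> \<open>Length \<open>c = 0\<close> leaves the old error, which gives
    monotonicity.\<close>
  show ?case using pcg_step[OF W, where B = B and v = v and i = i and c = 0] B step.IH
    by (simp add: T_def del: pcg_u.simps)
qed

section \<open>Coarse grid correction and energy projection\<close>

lemma energy_projection:
  assumes "subspace W"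
  obtains q where "q \<in> W" "\<And>z. z \<in> W \<Longrightarrow> op_inner A (x - q) z = 0"
proof -
  have "linear (op_inner A x)" by (simp add: linearI op_algebra)
  from spd_riesz[OF assms spd this] obtain q where
    "q \<in> W" "\<And>z. z \<in> W \<Longrightarrow> op_inner A q z = op_inner A x z" by blast
  then show thesis by (intro that[of q]) (simp_all add: op_algebra)
qed

text \<open>Tested against any \<open>z\<close> in \<open>W\<close>, both sides give the energy
  product of \<open>x\<close> with \<open>z\<close>, since \<open>x - q\<close> is energy orthogonal
  to \<open>W\<close>.\<close>

lemma orth_proj_level_op:
  assumes W: "subspace W" "subspace W'" "W \<subseteq> W'" and q: "q \<in> W"
    and orth: "\<And>z. z \<in> W \<Longrightarrow> op_inner A (x - q) z = 0"
  shows "orth_proj W (level_op A W' x) = level_op A W q"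
proof (rule inner_unique[OF W(1)])
  fix z assume z: "z \<in> W"
  then have "orth_proj W (level_op A W' x) \<bullet> z = op_inner A x z"
    using W by (simp add: orth_proj_inner level_op_inner subsetD)
  also have "\<dots> = level_op A W q \<bullet> z"
    using orth[OF z] z W(1) by (simp add: level_op_inner op_algebra)
  finally show "orth_proj W (level_op A W' x) \<bullet> z = level_op A W q \<bullet> z" .
qed (use W in \<open>auto simp: orth_proj level_op\<close>)

lemma energy_pythagoras:
  assumes W: "subspace W" and "q \<in> W" "y \<in> W"
    and orth: "\<And>z. z \<in> W \<Longrightarrow> op_inner A (x - q) z = 0"
  shows "op_inner A (x - y) (x - y) = op_inner A (x - q) (x - q) + op_inner A (q - y) (q - y)"
proof -
  have "op_inner A (x - q) (q - y) = 0" using assms by (simp add: subspace_diff)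
  moreover have "x - y = (x - q) + (q - y)" by simp
  ultimately show ?thesis
    using op_commute[of "q - y" "x - q"] by (simp only: op_algebra)
qed

text \<open>By Pythagoras the two squared errors share the term of \<open>x - q\<close>, which no
  correction from \<open>W\<close> can reach; only the distances to \<open>q\<close> differ.\<close>

lemma coarse_correction_mono:
  assumes W: "subspace W" and q: "q \<in> W" "\<And>z. z \<in> W \<Longrightarrow> op_inner A (x - q) z = 0"
    and y: "y \<in> W" "y' \<in> W" and le: "op_norm A (q - y) \<le> op_norm A (q - y')"
  shows "op_norm A (x - y) \<le> op_norm A (x - y')"
  using le energy_pythagoras[OF W q(1) y(1) q(2)] energy_pythagoras[OF W q(1) y(2) q(2)]
  by (simp add: op_norm_def)

end

section \<open>Comparison of the cycles across the levels\<close>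

locale multilevel = fin_dim_spd A
  for A :: "'a::real_inner \<Rightarrow> 'a" +
  fixes V :: "nat \<Rightarrow> 'a set" and R :: "nat \<Rightarrow> 'a \<Rightarrow> 'a" and J :: nat
  assumes V_subspace: "i \<in> {1..J} \<Longrightarrow> subspace (V i)"
    and V_mono: "i \<in> {1..<J} \<Longrightarrow> V i \<subseteq> V (Suc i)"
    and R_in: "i \<in> {2..J} \<Longrightarrow> f \<in> V i \<Longrightarrow> R i f \<in> V i"
begin

lemma backslash_cycle_in:
  "Suc j \<le> J \<Longrightarrow> f \<in> V (Suc j) \<Longrightarrow> backslash_cycle A V R (Suc j) f \<in> V (Suc j)"
proof (induction j arbitrary: f)
  case 0
  then show ?case using V_subspace by (simp add: level_inv_in)
next
  case (Suc j)
  have "backslash_cycle A V R (Suc j) (orth_proj (V (Suc j)) g) \<in> V (Suc (Suc j))" for g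
    using Suc V_subspace V_mono[of "Suc j"] orth_proj_in by auto
  then show ?case using Suc.prems V_subspace R_in by (auto simp: Let_def subspace_add)
qed

lemma amli_hat_in:
  "Suc j \<le> J \<Longrightarrow> f \<in> V (Suc j) \<Longrightarrow> amli_hat n A V R (Suc j) f \<in> V (Suc j)"
proof (induction j arbitrary: f)
  case 0
  then show ?case using V_subspace by (simp add: level_inv_in)
next
  case (Suc j)
  have "pcg_u (level_op A (V (Suc j))) (amli_hat n A V R (Suc j)) (orth_proj (V (Suc j)) g) n
      \<in> V (Suc (Suc j))" for g
    using Suc V_subspace V_mono[of "Suc j"] orth_proj_in pcg_u_in[of "V (Suc j)"] by auto
  then show ?case using Suc.prems V_subspace R_in by (auto simp: Let_def subspace_add)
qed

lemma amli_tilde_in: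
  assumes "Suc j \<le> J" "f \<in> V (Suc j)"
  shows "amli_tilde n A V R (Suc j) f \<in> V (Suc j)"
  unfolding amli_tilde_def using assms V_subspace by (intro pcg_u_in amli_hat_in) auto

lemma amli_tilde_le_hat:
  assumes "Suc j \<le> J" "n \<ge> 1"
  shows "op_norm A (v - amli_tilde n A V R (Suc j) (level_op A (V (Suc j)) v))
    \<le> op_norm A (v - amli_hat n A V R (Suc j) (level_op A (V (Suc j)) v))"
  unfolding amli_tilde_def using assms V_subspace by (intro pcg_error_le amli_hat_in) auto

text \<open>On the coarsest level both operators are \<open>level_inv\<close>. The vector
  \<open>v\<close> varies in the induction because the coarse level is entered with the projected
  error \<open>q\<close>.\<close>

lemma amli_hat_le_backslash:
  assumes "n \<ge> 1"
  shows "Suc j \<le> J \<Longrightarrow> v \<in> V (Suc j) \<Longrightarrow>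
    op_norm A (v - amli_hat n A V R (Suc j) (level_op A (V (Suc j)) v))
    \<le> op_norm A (v - backslash_cycle A V R (Suc j) (level_op A (V (Suc j)) v))"
proof (induction j arbitrary: v)
  case 0
  show ?case by simp
next
  case (Suc j)
  define W where "W = V (Suc j)"
  define W' where "W' = V (Suc (Suc j))"
  define u where "u = R (Suc (Suc j)) (level_op A W' v)"
  have W: "subspace W" "subspace W'" "W \<subseteq> W'" "Suc j \<le> J"
    using Suc.prems V_subspace V_mono by (auto simp: W_def W'_def)
  \<comment> \<open>\<open>q\<close> is the energy projection of the error \<open>v - u\<close> left
    by the smoother; it is the exact solution of the coarse problem that both cycles
    approximate.\<close>
  obtain q where q: "q \<in> W" "\<And>z. z \<in> W \<Longrightarrow> op_inner A (v - u - q) z = 0"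
    using energy_projection[OF W(1)] by metis
  have "level_op A W' v - level_op A W' u = level_op A W' (v - u)"
    using level_op_diff_scaleR[OF W(2), of v 1 u] by simp
  then have Q: "orth_proj W (level_op A W' v - level_op A W' u) = level_op A W q"
    using orth_proj_level_op[OF W(1-3) q] by simp
  let ?y = "amli_tilde n A V R (Suc j) (level_op A W q)"
  let ?y' = "backslash_cycle A V R (Suc j) (level_op A W q)"
  \<comment> \<open>PCG improves on the coarse preconditioner, which by the induction hypothesis
    improves on the coarse \<open>backslash_cycle\<close>.\<close>
  have "op_norm A (q - ?y) \<le> op_norm A (q - ?y')"
    using amli_tilde_le_hat[OF W(4) assms] Suc.IH[OF W(4)] q(1)
    unfolding W_def by (meson order_trans)
  moreover have "?y \<in> W" "?y' \<in> W"
    using level_op_in[OF W(1)] amli_tilde_in backslash_cycle_in W(4) by (auto simp: W_def)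
  ultimately have "op_norm A (v - u - ?y) \<le> op_norm A (v - u - ?y')"
    using coarse_correction_mono[OF W(1) q] by blast
  then show ?case
    using Q by (simp add: Let_def amli_tilde_def diff_diff_eq flip: W_def W'_def u_def)
qed

end

theorem theorem3p3:
  fixes A :: "'a::real_inner \<Rightarrow> 'a"
    and V :: "nat \<Rightarrow> 'a set"
    and R :: "nat \<Rightarrow> 'a \<Rightarrow> 'a"
    and J n k :: nat
    and v :: 'a
  assumes "\<exists>S :: 'a set. finite S \<and> span S = UNIV"
    and "spd A"
    and "J \<ge> 1"
    and "\<forall>i\<in>{1..J}. subspace (V i)"
    and "\<forall>i\<in>{1..<J}. V i \<subseteq> V (Suc i)"
    and "V J = UNIV"
    and "\<forall>i\<in>{2..J}. linear_endo_on (V i) (R i)"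
    and "n \<ge> 1"
    and "k \<in> {1..J}"
    and "v \<in> V k"
  shows "op_norm (level_op A (V k)) (v - amli_tilde n A V R k (level_op A (V k) v))
           \<le> op_norm (level_op A (V k)) (v - amli_hat n A V R k (level_op A (V k) v))
       \<and> op_norm (level_op A (V k)) (v - amli_hat n A V R k (level_op A (V k) v))
           \<le> op_norm (level_op A (V k)) (v - backslash_cycle A V R k (level_op A (V k) v))"
proof -
  interpret multilevel A V R J
    using assms by unfold_locales (auto simp: linear_endo_on_def image_subset_iff)
  obtain j where k: "k = Suc j" "Suc j \<le> J" using assms(9) by (cases k) auto
  let ?f = "level_op A (V k) v"
  have W: "subspace (V k)" using V_subspace assms(9) by simp
  have "?f \<in> V k" using level_op_in[OF W] .
  then have "amli_tilde n A V R k ?f \<in> V k" "amli_hat n A V R k ?f \<in> V k"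
    "backslash_cycle A V R k ?f \<in> V k"
    using k amli_tilde_in amli_hat_in backslash_cycle_in by auto
  \<comment> \<open>All three errors lie in \<open>V k\<close>, where the level norm equals the norm
    of \<open>A\<close>.\<close>
  then show ?thesis
    using amli_tilde_le_hat[OF k(2) assms(8)] amli_hat_le_backslash[OF assms(8) k(2)]
      assms(10) W k(1)
    by (simp add: op_norm_level_op subspace_diff)
qed

end
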